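(* Let $B=\{s\in\mathbb{C}:\Re(s)\in(0,1)\}$, let $w\in B$ and $z\in\mathbb{C}$. Then $\sup_{t\ge 1}|\psi_w(z,t)|<+\infty$ if and only if $z=z_w$, where \[ z_w=-\int_1^{+\infty}u^{-1-w}\{u\}\,du . \] Further, there exists $c_w>0$ such that \[ \left|\psi_w(z_w,t)+\frac{1}{2w}\right|<c_w\,t^{-1},\qquad \forall t\ge 1 . \]
   Context: $\{u\}$ denotes the fractional part of the real number $u$. For $w\in B$ and $z\in\mathbb{C}$, $\psi_w(z,\cdot):[1,+\infty)\to\mathbb{C}$ denotes the unique continuous function $x:[1,+\infty)\to\mathbb{C}$ with $x(1)=z$ satisfying the differential equation \[ \frac{d}{dt}x=w\,t^{-1}x+t^{-1}\{t\},\qquad t\in[1,+\infty)\setminus\mathbb{N}; \] explicitly, $\psi_w(z,t)=t^{w}\left[z+\int_1^t u^{-1-w}\{u\}\,du\right]$ for all $t\ge 1$. *)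

theory Defs
  imports "HOL-Analysis.Analysis"
begin

definition strip :: "complex set" where
  "strip = {s. 0 < Re s \<and> Re s < 1}"

definition is_solution :: "complex \<Rightarrow> complex \<Rightarrow> (real \<Rightarrow> complex) \<Rightarrow> bool" where
  "is_solution w z x \<longleftrightarrow>
     continuous_on {1..} x \<and> x 1 = z \<and>
     (\<forall>t\<in>{1..} - \<nat>.
        (x has_vector_derivative
          (w * of_real (inverse t) * x t + of_real (inverse t * frac t))) (at t))"

text \<open>
  A solution is only determined on \<open>{1..}\<close>, so the values \<open>psi w z t\<close>, rather than
  a function on all reals, are singled out by the definite description; they are meaningful for
  \<open>t \<ge> 1\<close> (see \<open>psi_is_solution\<close> and \<open>psi_explicit\<close> below).
\<close>
definition psi :: "complex \<Rightarrow> complex \<Rightarrow> real \<Rightarrow> complex" where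
  "psi w z t = (THE y. \<exists>x. is_solution w z x \<and> y = x t)"

text \<open>
  For \<open>w \<in> strip\<close> the integrand is dominated by \<open>u powr (- 1 - Re w)\<close>, so the
  Henstock--Kurzweil integral agrees with the Lebesgue and the improper Riemann integral.
\<close>
definition zw :: "complex \<Rightarrow> complex" where
  "zw w = - integral {1..} (\<lambda>u::real. of_real u powr (- 1 - w) * of_real (frac u))"

lemma has_vector_derivative_of_real_powr:
  fixes a :: complex and t :: real
  assumes "0 < t"
  shows "((\<lambda>u. of_real u powr a) has_vector_derivative a * of_real t powr (a - 1)) (at t)"
  using has_vector_derivative_real_field[OF has_field_derivative_powr[of "of_real t" a]] assms
  by (simp add: complex_nonpos_Reals_iff)

lemma finite_Nats_Icc: "finite (\<nat> \<inter> {1..b::real})"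
proof -
  have "\<nat> \<inter> {1..b} \<subseteq> real ` {..nat \<lceil>b\<rceil>}"
    by (auto simp: Nats_def image_iff) linarith
  then show ?thesis by (rule finite_subset) auto
qed

lemma is_solution_explicit:
  assumes sol: "is_solution w z x" and t: "1 \<le> t"
  shows "x t = of_real t powr w *
           (z + integral {1..t} (\<lambda>u. of_real u powr (- 1 - w) * of_real (frac u)))"
proof -
  let ?g = "\<lambda>u::real. of_real u powr (- 1 - w) * of_real (frac u) :: complex"
  let ?y = "\<lambda>u::real. of_real u powr (- w) * x u"
  have "(?g has_integral (?y t - ?y 1)) {1..t}"
  proof (rule fundamental_theorem_of_calculus_interior_strong[OF finite_Nats_Icc[of t] t])
    fix u assume u: "u \<in> {1<..<t} - \<nat> \<inter> {1..t}"
    then have "u > 0" and "(x has_vector_derivative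
        (w * of_real (inverse u) * x u + of_real (inverse u * frac u))) (at u)"
      using sol unfolding is_solution_def by auto
    from has_vector_derivative_mult[OF has_vector_derivative_of_real_powr[OF this(1)] this(2), of "- w"]
    have "(?y has_vector_derivative
       (of_real u powr (- w) * (w * of_real (inverse u) * x u + of_real (inverse u * frac u))
         + (- w * of_real u powr (- w - 1)) * x u)) (at u)" by simp
    moreover have "of_real u powr (- w - 1) = of_real u powr (- w) / of_real u"
      using \<open>u > 0\<close> by (simp add: powr_diff)
    moreover have "of_real u powr (- 1 - w) = of_real u powr (- w) / of_real u"
    proof -
      have "- 1 - w = - w - 1" by simp
      then show ?thesis using \<open>u > 0\<close> by (simp only: powr_diff) simp
    qed
    ultimately show "(?y has_vector_derivative ?g u) (at u)"
      by (simp add: field_simps)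
  next
    have "continuous_on {1..t} x"
      using sol unfolding is_solution_def by (auto intro: continuous_on_subset)
    then show "continuous_on {1..t} ?y"
      by (intro continuous_intros) (auto simp: complex_nonpos_Reals_iff)
  qed
  then have "integral {1..t} ?g = of_real t powr (- w) * x t - z"
    using sol unfolding is_solution_def by (simp add: integral_unique)
  moreover have "of_real t powr w * of_real t powr (- w) = (1::complex)"
    using t by (simp flip: powr_add)
  ultimately show ?thesis
    by (simp add: mult.assoc[symmetric])
qed

lemma is_solution_exists:
  "is_solution w z (\<lambda>t. of_real t powr w *
     (z + integral {1..t} (\<lambda>u. of_real u powr (- 1 - w) * of_real (frac u))))"
proof -
  let ?g = "\<lambda>u::real. of_real u powr (- 1 - w) * of_real (frac u) :: complex"
  let ?G = "\<lambda>t. integral {1..t} ?g"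
  have int: "?g integrable_on {1..b}" for b
  proof (rule measurable_bounded_by_integrable_imp_integrable)
    have "(\<lambda>u::real. of_real u powr (- 1 - w) :: complex) \<in> borel_measurable (lebesgue_on {1..b})"
      by (intro continuous_imp_measurable_on_sets_lebesgue continuous_intros)
         (auto simp: complex_nonpos_Reals_iff)
    moreover have "(\<lambda>u::real. of_real (frac u) :: complex) \<in> borel_measurable borel"
      unfolding frac_def by measurable
    then have "(\<lambda>u::real. of_real (frac u) :: complex) \<in> borel_measurable (lebesgue_on {1..b})"
      by (intro measurable_restrict_space1 measurable_completion) simp
    ultimately show "?g \<in> borel_measurable (lebesgue_on {1..b})"
      by (rule borel_measurable_times)
    show "(\<lambda>u::real. norm (of_real u powr (- 1 - w) :: complex)) integrable_on {1..b}"
      by (intro integrable_continuous_real continuous_intros)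
         (auto simp: complex_nonpos_Reals_iff)
    fix u :: real
    have "\<bar>frac u\<bar> \<le> 1" using frac_ge_0[of u] frac_lt_1[of u] by linarith
    then show "norm (?g u) \<le> norm (of_real u powr (- 1 - w) :: complex)"
      by (simp add: norm_mult mult_left_le)
  qed simp
  have cont: "continuous_on {1..} ?G"
    unfolding continuous_on_eq_continuous_within
  proof
    fix t :: real assume t: "t \<in> {1..}"
    have "continuous_on {1..t+1} ?G"
      by (rule indefinite_integral_continuous_1[OF int])
    then have "continuous (at t within {1..t+1}) ?G"
      using t by (simp add: continuous_on_eq_continuous_within)
    moreover have "at t within {1..t+1} = at t within {1..}"
      by (rule at_within_nhd[where S = "{..<t+1}"]) auto
    ultimately show "continuous (at t within {1..}) ?G" by simp
  qed
  have der: "(?G has_vector_derivative ?g t) (at t)" if "t \<in> {1..} - \<nat>" for t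
  proof -
    from that have t: "1 < t" "t \<notin> \<int>"
      by (auto simp: less_le Nats_altdef2)
    have "isCont frac t" using t(2) by (rule continuous_frac)
    then have "isCont ?g t"
      using t by (intro continuous_intros) (auto simp: complex_nonpos_Reals_iff)
    then have "continuous (at t within {1..t+1} - {}) ?g"
      by (simp add: continuous_at_imp_continuous_within)
    from integral_has_vector_derivative_continuous_at[OF int _ _ this] t
    have "(?G has_vector_derivative ?g t) (at t within {1..t+1})" by simp
    moreover have "at t within {1..t+1} = at t"
      using t by (intro at_within_interior) simp
    ultimately show ?thesis by simp
  qed
  show ?thesis
    unfolding is_solution_def
  proof (intro conjI ballI)
    show "continuous_on {1..} (\<lambda>t. of_real t powr w * (z + ?G t))"
      by (intro continuous_intros cont) (auto simp: complex_nonpos_Reals_iff)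
    show "of_real 1 powr w * (z + ?G 1) = z" by simp
    fix t :: real assume t: "t \<in> {1..} - \<nat>"
    then have "t > 0" by auto
    have "((\<lambda>t. z + ?G t) has_vector_derivative ?g t) (at t)"
      using has_vector_derivative_add[OF has_vector_derivative_const der[OF t]] by simp
    from has_vector_derivative_mult[OF has_vector_derivative_of_real_powr[OF \<open>t > 0\<close>] this, of w]
    have "((\<lambda>t. of_real t powr w * (z + ?G t)) has_vector_derivative
        of_real t powr w * ?g t + w * of_real t powr (w - 1) * (z + ?G t)) (at t)" .
    moreover have "of_real t powr (w - 1) = of_real t powr w / of_real t"
      using \<open>t > 0\<close> by (simp add: powr_diff)
    moreover have "of_real t powr w * of_real t powr (- 1 - w) = 1 / (of_real t :: complex)"
      using \<open>t > 0\<close> by (simp add: powr_minus inverse_eq_divide flip: powr_add)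
    then have "of_real t powr w * ?g t = of_real (inverse t * frac t)"
      by (simp add: mult.assoc[symmetric] inverse_eq_divide)
    ultimately show "((\<lambda>t. of_real t powr w * (z + ?G t)) has_vector_derivative
        w * of_real (inverse t) * (of_real t powr w * (z + ?G t)) + of_real (inverse t * frac t)) (at t)"
      by (simp add: field_simps)
  qed
qed

lemma psi_explicit:
  assumes "1 \<le> t"
  shows "psi w z t = of_real t powr w *
           (z + integral {1..t} (\<lambda>u. of_real u powr (- 1 - w) * of_real (frac u)))"
  unfolding psi_def
proof (rule the_equality)
  show "\<exists>x. is_solution w z x \<and> of_real t powr w *
      (z + integral {1..t} (\<lambda>u. of_real u powr (- 1 - w) * of_real (frac u))) = x t"
    by (rule exI conjI is_solution_exists refl)+
qed (auto simp: is_solution_explicit[OF _ assms])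

lemma psi_is_solution: "is_solution w z (psi w z)"
proof -
  let ?x = "\<lambda>t. of_real t powr w *
     (z + integral {1..t} (\<lambda>u. of_real u powr (- 1 - w) * of_real (frac u)))"
  have eq: "psi w z t = ?x t" if "1 \<le> t" for t
    using that by (rule psi_explicit)
  have sol: "is_solution w z ?x" by (rule is_solution_exists)
  show ?thesis
    unfolding is_solution_def
  proof (intro conjI ballI)
    have "continuous_on {1..} ?x" using sol unfolding is_solution_def by blast
    then show "continuous_on {1..} (psi w z)"
      by (rule continuous_on_eq) (simp add: eq)
    show "psi w z 1 = z" by (simp add: eq)
    fix t :: real assume t: "t \<in> {1..} - \<nat>"
    then have "1 < t" by (auto simp: less_le)
    have "(?x has_vector_derivative
        (w * of_real (inverse t) * ?x t + of_real (inverse t * frac t))) (at t)"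
      using sol t unfolding is_solution_def by blast
    then have "(?x has_vector_derivative
        (w * of_real (inverse t) * psi w z t + of_real (inverse t * frac t))) (at t)"
      using \<open>1 < t\<close> by (simp only: eq less_imp_le)
    then show "(psi w z has_vector_derivative
        (w * of_real (inverse t) * psi w z t + of_real (inverse t * frac t))) (at t)"
      by (rule has_vector_derivative_transform_within_open[where S = "{1<..}"])
         (use \<open>1 < t\<close> in \<open>auto simp: eq\<close>)
  qed
qed

end

theory Submission
  imports Defs
begin

text \<open>
  The function \<open>H u = (frac u ^ 2 - frac u) / 2\<close> is a bounded continuous primitive of
  \<open>frac u - 1 / 2\<close>.  Integrating \<open>u powr (- 1 - w) * frac u\<close> by parts over \<open>{t..}\<close>
  with it gives \<open>t powr (- w) / (2 * w)\<close> up to an error \<open>O(t powr (- 1 - Re w))\<close>, and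
  multiplying by \<open>t powr w\<close> turns this into the asymptotics of \<open>psi w (zw w)\<close>.  Any other
  solution differs from that one by a nonzero multiple of the unbounded function
  \<open>t powr w\<close>.
\<close>

section \<open>The periodic primitive of the centred fractional part\<close>

definition frac_primitive :: "real \<Rightarrow> real" where
  "frac_primitive u = (frac u ^ 2 - frac u) / 2"

text \<open>With \<open>f = frac u\<close>, the absolute value equals
  \<open>f * (1 - f) / 2\<close>, and either factor can be bounded by 1. The first bound is sharp
  enough just to the right of an integer, the second just to the left.\<close>

lemma abs_frac_primitive_le_frac: "\<bar>frac_primitive u\<bar> \<le> frac u"
  and abs_frac_primitive_le_1_minus_frac: "\<bar>frac_primitive u\<bar> \<le> 1 - frac u"
proof -
  have f: "0 \<le> frac u" "frac u < 1" by (simp_all add: frac_lt_1)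
  have "frac_primitive u = - (frac u * (1 - frac u) / 2)"
    by (simp add: frac_primitive_def power2_eq_square field_simps)
  then have eq: "\<bar>frac_primitive u\<bar> = frac u * (1 - frac u) / 2"
    using f by simp
  have "frac u * (1 - frac u) \<le> frac u" "frac u * (1 - frac u) \<le> 1 - frac u"
    using f by (simp_all add: mult_left_le mult_left_le_one_le)
  then show "\<bar>frac_primitive u\<bar> \<le> frac u" "\<bar>frac_primitive u\<bar> \<le> 1 - frac u"
    using f unfolding eq by linarith+
qed

lemma abs_frac_primitive_le_1: "\<bar>frac_primitive u\<bar> \<le> 1"
  using abs_frac_primitive_le_frac[of u] frac_lt_1[of u] by linarith

text \<open>To the right of \<open>n\<close> the distance is at least \<open>frac u\<close>, to the
  left at least \<open>1 - frac u\<close>. This supplies the squeeze for continuity at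
  integers.\<close>

lemma abs_frac_primitive_le_dist_int: "\<bar>frac_primitive u\<bar> \<le> \<bar>u - of_int n\<bar>"
proof (cases "of_int n \<le> u")
  case True
  then have "n \<le> \<lfloor>u\<rfloor>" by (simp add: le_floor_iff)
  then have "frac u \<le> u - of_int n" by (simp add: frac_def)
  then show ?thesis using abs_frac_primitive_le_frac[of u] by linarith
next
  case False
  then have "\<lfloor>u\<rfloor> + 1 \<le> n" by linarith
  then have "real_of_int \<lfloor>u\<rfloor> + 1 \<le> of_int n" by linarith
  then have "1 - frac u \<le> of_int n - u" by (simp add: frac_def)
  then show ?thesis using abs_frac_primitive_le_1_minus_frac[of u] by linarith
qed

text \<open>The jump of \<open>frac\<close> from 1 to 0 is invisible here, because
  \<open>x ^ 2 - x\<close> vanishes at both values. Hence the integration by parts produces no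
  boundary terms at integers.\<close>

lemma isCont_frac_primitive: "isCont frac_primitive u"
proof (cases "u \<in> \<int>")
  case True
  then obtain n where n: "u = of_int n" by (auto elim: Ints_cases)
  have "((\<lambda>v. \<bar>v - of_int n\<bar>) \<longlongrightarrow> \<bar>u - of_int n\<bar>) (at u)"
    by (intro tendsto_intros)
  then have "(frac_primitive \<longlongrightarrow> 0) (at u)"
    using abs_frac_primitive_le_dist_int
    by (intro Lim_null_comparison[of frac_primitive "\<lambda>v. \<bar>v - of_int n\<bar>"]) (auto simp: n)
  then show ?thesis by (simp add: isCont_def n frac_primitive_def)
next
  case False
  show ?thesis
    unfolding frac_primitive_def by (intro continuous_intros continuous_frac False) auto
qed

text \<open>Between consecutive integers the floor is constant, so the function coincides locally
  with the quadratic polynomial \<open>?p\<close>.\<close>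

lemma has_real_derivative_frac_primitive:
  assumes "u \<notin> \<int>"
  shows "(frac_primitive has_real_derivative (frac u - 1 / 2)) (at u)"
proof -
  let ?p = "\<lambda>v. ((v - of_int \<lfloor>u\<rfloor>) ^ 2 - (v - of_int \<lfloor>u\<rfloor>)) / 2"
  have "u \<noteq> of_int \<lfloor>u\<rfloor>" using assms by (metis Ints_of_int)
  then have "of_int \<lfloor>u\<rfloor> < u" by linarith
  then have "u \<in> {of_int \<lfloor>u\<rfloor> <..< of_int \<lfloor>u\<rfloor> + 1}" by auto
  moreover have "?p v = frac_primitive v" if "v \<in> {of_int \<lfloor>u\<rfloor> <..< of_int \<lfloor>u\<rfloor> + 1}" for v
  proof -
    from that have "\<lfloor>v\<rfloor> = \<lfloor>u\<rfloor>" by (intro floor_unique) auto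
    then show ?thesis by (simp add: frac_primitive_def frac_def)
  qed
  moreover have "(?p has_real_derivative (frac u - 1 / 2)) (at u)"
    by (auto intro!: derivative_eq_intros simp: frac_def)
  ultimately show ?thesis
    using has_field_derivative_transform_within_open[OF _ open_greaterThanLessThan] by blast
qed

section \<open>Convergence of the improper integral\<close>

lemma norm_powr_of_real: "0 < u \<Longrightarrow> cmod (of_real u powr a) = u powr Re a"
  using norm_powr_real_powr[of "of_real u" a] by simp

text \<open>Since \<open>frac\<close> takes values in [0, 1), the integrand is measurable and
  dominated by \<open>u powr (- 1 - Re w)\<close>, which is integrable at infinity because
  \<open>Re w\<close> is positive.\<close>

lemma integrable_powr_frac:
  fixes w :: complex
  assumes "0 < Re w" "1 \<le> a"
  shows "(\<lambda>u. of_real u powr (- 1 - w) * of_real (frac u)) integrable_on {a..}"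
proof (rule measurable_bounded_by_integrable_imp_integrable)
  have "(\<lambda>u::real. of_real u powr (- 1 - w) :: complex) \<in> borel_measurable (lebesgue_on {a..})"
    using assms by (intro continuous_imp_measurable_on_sets_lebesgue continuous_intros)
       (auto simp: complex_nonpos_Reals_iff)
  moreover have "(\<lambda>u::real. of_real (frac u) :: complex) \<in> borel_measurable borel"
    unfolding frac_def by measurable
  then have "(\<lambda>u::real. of_real (frac u) :: complex) \<in> borel_measurable (lebesgue_on {a..})"
    by (intro measurable_restrict_space1 measurable_completion) simp
  ultimately show "(\<lambda>u. of_real u powr (- 1 - w) * of_real (frac u))
      \<in> borel_measurable (lebesgue_on {a..})"
    by (rule borel_measurable_times)
  show "(\<lambda>u. u powr (- 1 - Re w)) integrable_on {a..}"
    using has_integral_powr_to_inf[of "- 1 - Re w" a] assms by (auto simp: integrable_on_def)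
  fix u :: real assume "u \<in> {a..}"
  then show "cmod (of_real u powr (- 1 - w) * of_real (frac u)) \<le> u powr (- 1 - Re w)"
    using assms frac_lt_1[of u] by (simp add: norm_mult norm_powr_of_real mult_left_le)
qed simp

lemma integral_powr_frac_tendsto_zw:
  fixes w :: complex
  assumes "0 < Re w"
  shows "((\<lambda>t. integral {1..t} (\<lambda>u. of_real u powr (- 1 - w) * of_real (frac u)))
    \<longlongrightarrow> - zw w) at_top"
proof -
  let ?g = "\<lambda>u::real. of_real u powr (- 1 - w) * of_real (frac u) :: complex"
  \<comment> \<open>The left side is the norm of the tail integral over \<open>{t..}\<close>, which
    the dominating power controls.\<close>
  have le: "cmod (integral {1..t} ?g + zw w) \<le> t powr (- Re w) / Re w" if "1 \<le> t" for t
  proof -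
    have pow: "((\<lambda>u. u powr (- 1 - Re w)) has_integral t powr (- Re w) / Re w) {t..}"
      using has_integral_powr_to_inf[of "- 1 - Re w" t] assms that by simp
    have "?g integrable_on {1..t}"
      by (rule integrable_on_subinterval[OF integrable_powr_frac[OF assms order_refl]]) auto
    then have "(?g has_integral integral {1..t} ?g + integral {t..} ?g) ({1..t} \<union> {t..})"
      by (rule has_integral_Un[OF integrable_integral
            integrable_integral[OF integrable_powr_frac[OF assms that]]])
         (auto intro: negligible_subset[of "{t}"])
    moreover have "{1..t} \<union> {t..} = {1..}" using that by auto
    ultimately have "integral {1..} ?g = integral {1..t} ?g + integral {t..} ?g"
      by (simp add: integral_unique)
    then have "cmod (integral {1..t} ?g + zw w) = cmod (integral {t..} ?g)"
      by (simp add: zw_def norm_minus_commute)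
    also have "\<dots> \<le> integral {t..} (\<lambda>u. u powr (- 1 - Re w))"
      using pow integrable_powr_frac[OF assms that] that
      by (intro integral_norm_bound_integral)
         (auto simp: norm_mult norm_powr_of_real mult_left_le less_imp_le[OF frac_lt_1])
    finally show ?thesis using pow by (simp add: integral_unique)
  qed
  have "((\<lambda>t. t powr (- Re w) / Re w) \<longlongrightarrow> 0 / Re w) at_top"
    using assms by (intro tendsto_intros tendsto_neg_powr filterlim_ident) auto
  then have "((\<lambda>t. integral {1..t} ?g + zw w) \<longlongrightarrow> 0) at_top"
    by (intro Lim_null_comparison[OF eventually_mono[OF eventually_ge_at_top[of 1] le]]) simp_all
  then have "((\<lambda>t. integral {1..t} ?g + zw w - zw w) \<longlongrightarrow> 0 - zw w) at_top"
    by (rule tendsto_diff) simp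
  then show ?thesis by simp
qed

section \<open>Integration by parts and the asymptotics\<close>

text \<open>Split \<open>frac u\<close> into \<open>1 / 2\<close> and \<open>frac u - 1 / 2\<close>,
  integrate the first part exactly and the second by parts. \<open>E\<close> collects the boundary
  terms. The remaining integrand \<open>?k\<close> gains a factor \<open>1 / u\<close>, and
  extending its majorant to infinity makes the bound independent of \<open>s\<close>.\<close>

lemma integral_powr_frac_by_parts_bound:
  fixes w :: complex
  assumes w: "0 < Re w" and t: "1 \<le> t" "t \<le> s"
  defines "E \<equiv> \<lambda>u. of_real u powr (- 1 - w) * of_real (frac_primitive u)
    - of_real u powr (- w) / (2 * w)"
  shows "cmod (integral {t..s} (\<lambda>u. of_real u powr (- 1 - w) * of_real (frac u)) - (E s - E t))
    \<le> cmod (1 + w) * (t powr (- 1 - Re w) / (1 + Re w))"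
proof -
  let ?g = "\<lambda>u::real. of_real u powr (- 1 - w) * of_real (frac u) :: complex"
  let ?k = "\<lambda>u::real. (1 + w) * (of_real u powr (- 2 - w) * of_real (frac_primitive u))"
  have "w \<noteq> 0" using w by auto
  have "((\<lambda>u. ?g u - ?k u) has_integral (E s - E t)) {t..s}"
  \<comment> \<open>The finitely many integers, where \<open>frac_primitive\<close> has corners, are
    exempted; there continuity of \<open>E\<close> suffices.\<close>
  proof (rule fundamental_theorem_of_calculus_interior_strong[where S = "\<nat> \<inter> {1..s}"])
    fix u assume u: "u \<in> {t<..<s} - \<nat> \<inter> {1..s}"
    then have "u > 0" "u \<notin> \<int>" using t by (auto simp: Nats_altdef2)
    have H: "((\<lambda>u. of_real (frac_primitive u)) has_vector_derivative
        (of_real (frac u - 1 / 2) :: complex)) (at u)"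
      by (intro has_vector_derivative_of_real has_real_derivative_frac_primitive \<open>u \<notin> \<int>\<close>)
    have "(E has_vector_derivative
        of_real u powr (- 1 - w) * of_real (frac u - 1 / 2)
        + (- 1 - w) * of_real u powr (- 1 - w - 1) * of_real (frac_primitive u)
        - (- w) * of_real u powr (- w - 1) / (2 * w)) (at u)"
      unfolding E_def
      by (intro has_vector_derivative_diff has_vector_derivative_divide
          has_vector_derivative_mult[OF has_vector_derivative_of_real_powr H]
          has_vector_derivative_of_real_powr \<open>u > 0\<close>)
    \<comment> \<open>These identities bring equal exponents to one syntactic form, so that the
      powers can cancel.\<close>
    moreover have "- w - 1 = - 1 - w" "- 1 - w - 1 = - 2 - w" "- w - 2 = - 2 - w" by simp_all
    ultimately show "(E has_vector_derivative (?g u - ?k u)) (at u)"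
      using \<open>w \<noteq> 0\<close> by (simp add: algebra_simps)
  next
    have "continuous_on {t..s} frac_primitive"
      by (intro continuous_at_imp_continuous_on ballI isCont_frac_primitive)
    then show "continuous_on {t..s} E"
      unfolding E_def using t \<open>w \<noteq> 0\<close>
      by (intro continuous_intros) (auto simp: complex_nonpos_Reals_iff)
  qed (use t finite_Nats_Icc in auto)
  moreover have g: "?g integrable_on {t..s}"
    by (rule integrable_on_subinterval[OF integrable_powr_frac[OF w t(1)]]) auto
  ultimately have k: "(?k has_integral (integral {t..s} ?g - (E s - E t))) {t..s}"
    using has_integral_diff[OF integrable_integral] by fastforce
  have pow: "((\<lambda>u. u powr (- 2 - Re w)) has_integral t powr (- 1 - Re w) / (1 + Re w)) {t..}"
  proof -
    have "- (t powr (- 2 - Re w + 1)) / (- 2 - Re w + 1) = t powr (- 1 - Re w) / (1 + Re w)"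
      using w by (simp add: field_simps)
    then show ?thesis
      using has_integral_powr_to_inf[of "- 2 - Re w" t] w t by simp
  qed
  from pow have int: "(\<lambda>u. cmod (1 + w) * u powr (- 2 - Re w)) integrable_on {t..}"
    by (intro integrable_on_mult_right) auto
  then have int': "(\<lambda>u. cmod (1 + w) * u powr (- 2 - Re w)) integrable_on {t..s}"
    by (rule integrable_on_subinterval) auto
  have "cmod (integral {t..s} ?k) \<le> integral {t..s} (\<lambda>u. cmod (1 + w) * u powr (- 2 - Re w))"
    using k int' t
    by (intro integral_norm_bound_integral)
       (auto simp: norm_mult norm_powr_of_real abs_frac_primitive_le_1 intro!: mult_left_mono mult_left_le)
  also have "\<dots> \<le> integral {t..} (\<lambda>u. cmod (1 + w) * u powr (- 2 - Re w))"
    using int int' by (intro integral_subset_le) auto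
  also have "\<dots> = cmod (1 + w) * (t powr (- 1 - Re w) / (1 + Re w))"
    by (rule integral_unique[OF has_integral_mult_right[OF pow]])
  finally show ?thesis using integral_unique[OF k] by (simp only:)
qed

text \<open>Letting \<open>s\<close> tend to infinity in the previous bound turns it into a
  statement about the tail integral from \<open>t\<close>, and multiplication by
  \<open>t powr w\<close> gives the claim.\<close>

lemma psi_zw_asymptotics:
  assumes w: "0 < Re w" and t: "1 \<le> t"
  shows "cmod (psi w (zw w) t + 1 / (2 * w)) \<le> (cmod (1 + w) / (1 + Re w) + 1) * inverse t"
proof -
  let ?g = "\<lambda>u::real. of_real u powr (- 1 - w) * of_real (frac u) :: complex"
  let ?G = "\<lambda>t. integral {1..t} ?g"
  define E where "E = (\<lambda>u::real. of_real u powr (- 1 - w) * of_real (frac_primitive u)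
    - of_real u powr (- w) / (2 * w))"
  let ?C = "cmod (1 + w) / (1 + Re w)"
  have zero: "(E \<longlongrightarrow> 0) at_top"
  proof -
    have "((\<lambda>u::real. of_real u powr (- w) / (2 * w)) \<longlongrightarrow> 0 / (2 * w)) at_top"
      using w by (intro tendsto_intros tendsto_neg_powr_complex_of_real filterlim_ident) auto
    moreover have "((\<lambda>u::real. of_real u powr (- 1 - w) * of_real (frac_primitive u) :: complex)
        \<longlongrightarrow> 0) at_top"
    proof (rule Lim_null_comparison)
      show "\<forall>\<^sub>F u in at_top. cmod (of_real u powr (- 1 - w) * of_real (frac_primitive u))
          \<le> u powr (- 1 - Re w)"
        using eventually_gt_at_top[of "0::real"]
        by eventually_elim
           (simp add: norm_mult norm_powr_of_real mult_left_le abs_frac_primitive_le_1)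
      show "((\<lambda>u. u powr (- 1 - Re w)) \<longlongrightarrow> 0) at_top"
        using w by (intro tendsto_neg_powr filterlim_ident) auto
    qed
    ultimately show ?thesis unfolding E_def using tendsto_diff by fastforce
  qed
  have "((\<lambda>s. cmod (?G s - ?G t - (E s - E t))) \<longlongrightarrow> cmod (- zw w - ?G t - (0 - E t))) at_top"
    by (intro tendsto_intros integral_powr_frac_tendsto_zw[OF w] zero)
  moreover have "\<forall>\<^sub>F s in at_top. cmod (?G s - ?G t - (E s - E t)) \<le> ?C * t powr (- 1 - Re w)"
    using eventually_ge_at_top[of t]
  proof eventually_elim
    case (elim s)
    have "?g integrable_on {1..s}"
      by (rule integrable_on_subinterval[OF integrable_powr_frac[OF w order_refl]]) auto
    then have "?G t + integral {t..s} ?g = ?G s"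
      using t elim by (intro Henstock_Kurzweil_Integration.integral_combine) auto
    then have "?G s - ?G t = integral {t..s} ?g" by (simp add: algebra_simps)
    then show ?case
      using integral_powr_frac_by_parts_bound[OF w t elim] by (simp add: E_def)
  qed
  ultimately have "cmod (- zw w - ?G t - (0 - E t)) \<le> ?C * t powr (- 1 - Re w)"
    by (intro tendsto_upperbound) auto
  then have bound: "cmod (zw w + ?G t - E t) \<le> ?C * t powr (- 1 - Re w)"
    by (subst norm_minus_cancel[symmetric]) (simp add: algebra_simps)
  have powr: "of_real t powr w * of_real t powr (- w) = (1 :: complex)"
    "of_real t powr w * of_real t powr (- 1 - w) = (1 / of_real t :: complex)"
    using t by (simp_all add: powr_minus inverse_eq_divide flip: powr_add)
  \<comment> \<open>The main term of \<open>E\<close> becomes exactly \<open>- 1 / (2 * w)\<close>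
    and cancels the added constant; the other boundary term is of order
    \<open>1 / t\<close>.\<close>
  have "of_real t powr w * E t = of_real (frac_primitive t) / of_real t - 1 / (2 * w)"
    using powr by (simp add: E_def right_diff_distrib mult.assoc[symmetric])
  then have "psi w (zw w) t + 1 / (2 * w)
      = of_real t powr w * (zw w + ?G t - E t) + of_real (frac_primitive t) / of_real t"
    using t by (simp add: psi_explicit algebra_simps)
  also have "cmod \<dots> \<le> cmod (of_real t powr w) * cmod (zw w + ?G t - E t) + \<bar>frac_primitive t\<bar> / t"
    using t norm_triangle_ineq[of "of_real t powr w * (zw w + ?G t - E t)"
        "of_real (frac_primitive t) / of_real t"]
    by (simp add: norm_mult norm_divide)
  also have "\<dots> \<le> t powr Re w * (?C * t powr (- 1 - Re w)) + 1 / t"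
    using t bound abs_frac_primitive_le_1[of t]
    by (intro add_mono mult_mono divide_right_mono) (auto simp: norm_powr_of_real)
  also have "t powr Re w * (?C * t powr (- 1 - Re w)) = ?C * (t powr Re w * t powr (- 1 - Re w))"
    by simp
  also have "t powr Re w * t powr (- 1 - Re w) = inverse t"
    using t by (simp add: powr_minus flip: powr_add)
  finally show ?thesis by (simp add: algebra_simps inverse_eq_divide)
qed

section \<open>Uniqueness of the bounded solution and conclusion\<close>

lemma psi_diff:
  assumes "1 \<le> t"
  shows "psi w z t - psi w z' t = of_real t powr w * (z - z')"
  using assms by (simp add: psi_explicit algebra_simps)

text \<open>The difference of the two solutions has norm \<open>t powr Re w * cmod (z - z')\<close>,
  which stays bounded only if \<open>z = z'\<close>.\<close>

lemma psi_bounded_unique: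
  assumes w: "0 < Re w"
    and le: "\<And>t. 1 \<le> t \<Longrightarrow> cmod (psi w z t) \<le> M" "\<And>t. 1 \<le> t \<Longrightarrow> cmod (psi w z' t) \<le> M'"
  shows "z = z'"
proof -
  have "cmod (z - z') \<le> (M + M') * t powr (- Re w)" if "1 \<le> t" for t
  proof -
    have "t powr Re w * cmod (z - z') = cmod (psi w z t - psi w z' t)"
      using that by (simp add: psi_diff norm_mult norm_powr_of_real)
    also have "\<dots> \<le> M + M'"
      using norm_triangle_ineq4 le[OF that] by (meson add_mono order_trans)
    finally show ?thesis using that by (simp add: powr_minus field_simps)
  qed
  moreover have "((\<lambda>t. (M + M') * t powr (- Re w)) \<longlongrightarrow> (M + M') * 0) at_top"
    using w by (intro tendsto_intros tendsto_neg_powr filterlim_ident) auto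
  ultimately have "cmod (z - z') \<le> (M + M') * 0"
    by (intro tendsto_lowerbound) (auto intro: eventually_mono[OF eventually_ge_at_top[of 1]])
  then show ?thesis by simp
qed

theorem lemma2p4:
  fixes w :: complex
  assumes "w \<in> strip"
  shows "(\<forall>z. (SUP t\<in>{1..}. ereal (cmod (psi w z t))) < \<infinity> \<longleftrightarrow> z = zw w) \<and>
    (\<exists>c::real. c > 0 \<and>
       (\<forall>t\<ge>1. cmod (psi w (zw w) t + 1 / (2 * w)) < c * inverse t))"
proof -
  have w: "0 < Re w" using assms by (simp add: strip_def)
  \<comment> \<open>The quotient comes from the remainder integral, the summand 1 from the boundary
    term \<open>frac_primitive t / t\<close>.\<close>
  define c where "c = cmod (1 + w) / (1 + Re w) + 1"
  have "c > 0" using w by (simp add: c_def add_nonneg_pos)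
  have asym: "cmod (psi w (zw w) t + 1 / (2 * w)) \<le> c * inverse t" if "1 \<le> t" for t
    using psi_zw_asymptotics[OF w that] by (simp add: c_def)
  have bdd: "cmod (psi w (zw w) t) \<le> c + cmod (1 / (2 * w))" if "1 \<le> t" for t
  proof -
    have "c * inverse t \<le> c"
      using that \<open>c > 0\<close> by (simp add: field_simps)
    then show ?thesis
      using asym[OF that] norm_triangle_ineq4[of "psi w (zw w) t + 1 / (2 * w)" "1 / (2 * w)"]
      by simp
  qed
  have "(SUP t\<in>{1..}. ereal (cmod (psi w z t))) < \<infinity> \<longleftrightarrow> z = zw w" for z
  proof
    assume "(SUP t\<in>{1..}. ereal (cmod (psi w z t))) < \<infinity>"
    \<comment> \<open>A supremum below infinity lies below some natural number, which serves as a
      real bound.\<close>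
    then obtain M where "(SUP t\<in>{1..}. ereal (cmod (psi w z t))) < ereal M"
      by (auto dest: less_PInf_Ex_of_nat[THEN iffD1])
    then have "cmod (psi w z t) \<le> M" if "1 \<le> t" for t
      using that SUP_upper[of t "{1..}" "\<lambda>t. ereal (cmod (psi w z t))"]
      by (metis atLeast_iff ereal_less_eq(3) less_imp_le order_trans)
    then show "z = zw w" using psi_bounded_unique[OF w _ bdd] by blast
  next
    assume "z = zw w"
    then have "(SUP t\<in>{1..}. ereal (cmod (psi w z t))) \<le> ereal (c + cmod (1 / (2 * w)))"
      using bdd by (intro SUP_least) auto
    then show "(SUP t\<in>{1..}. ereal (cmod (psi w z t))) < \<infinity>"
      by (rule order.strict_trans1) simp
  qed
  \<comment> \<open>Enlarging the constant by 1 makes the inequality strict.\<close>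
  moreover have "cmod (psi w (zw w) t + 1 / (2 * w)) < (c + 1) * inverse t" if "1 \<le> t" for t
  proof -
    have "c * inverse t < (c + 1) * inverse t" using that by (simp add: field_simps)
    then show ?thesis using asym[OF that] by linarith
  qed
  moreover have "c + 1 > 0" using \<open>c > 0\<close> by simp
  ultimately show ?thesis by blast
qed

end
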